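(* Let $\mathcal{G}=(\mathcal{S}_{\mathcal G},\mathcal{M}_{\mathcal G},\mathcal{B}(H_{\mathcal G}))$ and $\mathcal{H}=(\mathcal{S}_{\mathcal H},\mathcal{M}_{\mathcal H},\mathcal{B}(H_{\mathcal H}))$ be quantum graphs, and let $\mathcal{G}\,\Box\,\mathcal{H}$ be their Cartesian product. Then $$\max\{\chi_{q}(\mathcal{G}),\chi_{q}(\mathcal{H})\}\leq\chi_{q}(\mathcal{G}\,\Box\,\mathcal{H}).$$
   Context: Quantum graphs. $H$ denotes a complex Hilbert space, $\mathcal{B}(H)$ its bounded operators, and $\mathcal{M}'$ the commutant of $\mathcal{M}$. An (irreflexive) quantum graph is a tuple $(\mathcal{S},\mathcal{M},\mathcal{B}(H))$ where $\mathcal{M}$ is a von Neumann subalgebra of $\mathcal{B}(H)$ and $\mathcal{S}\subseteq\mathcal{B}(H)$ is an operator space that is closed under adjoints, is a bimodule over $\mathcal{M}'$ (that is, $\mathcal{M}'\mathcal{S}\mathcal{M}'\subseteq\mathcal{S}$), and is contained in $(\mathcal{M}')^{\perp}$, the orthogonal complement being taken relative to some trace on $\mathcal{B}(H)$. Quantum chromatic number. $\chi_q(\mathcal{S},\mathcal{M},\mathcal{B}(H))$ is the minimum $c\in\mathbb{N}$ for which there are a finite-dimensional von Neumann algebra $\mathcal{N}$ (with a faithful normal tracial state) and operators $P_1,\dots,P_c\in\mathcal{M}\bar\otimes\mathcal{N}$ with $P_a^2=P_a=P_a^*$ for $1\le a\le c$, $\sum_{a=1}^cP_a=I_{\mathcal{M}\bar\otimes\mathcal{N}}$,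 and $P_a(X\otimes I_{\mathcal{N}})P_a=0$ for all $X\in\mathcal{S}$ and $1\le a\le c$; it is $\infty$ if none exists. Cartesian product. $\mathcal{G}\,\Box\,\mathcal{H}=(\mathcal{S}_{\mathcal K},\ \mathcal{M}_{\mathcal G}\bar\otimes\mathcal{M}_{\mathcal H},\ \mathcal{B}(H_{\mathcal G}\bar\otimes H_{\mathcal H}))$ with $\mathcal{S}_{\mathcal K}=\mathcal{S}_{\mathcal G}\otimes\mathcal{M}_{\mathcal H}'+\mathcal{M}_{\mathcal G}'\otimes\mathcal{S}_{\mathcal H}$.
   Formalization: The Hilbert spaces are taken nonzero, and the trace on B(H) is required to be faithful and finite everywhere, which makes H finite-dimensional; for the zero space, or infinite-dimensional H with a semifinite trace, the claim can fail. *)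

theory Defs
  imports "HOL-Analysis.Analysis" "HOL-Library.Extended_Nat"
begin

text \<open>
  A complex Hilbert space is represented, after choosing an orthonormal basis, as
  \<open>\<ell>\<^sup>2(X)\<close> for an arbitrary (possibly infinite) index set \<open>X\<close>, and an operator \<open>A\<close> on it by its
  matrix coefficients \<open>A i j = \<langle>e\<^sub>i, A e\<^sub>j\<rangle>\<close>, which vanish outside \<open>X \<times> X\<close>.  The Hilbert tensor
  product of \<open>\<ell>\<^sup>2(X)\<close> and \<open>\<ell>\<^sup>2(Y)\<close> is then \<open>\<ell>\<^sup>2(X \<times> Y)\<close>.
\<close>

type_synonym 'a mtx = "'a \<Rightarrow> 'a \<Rightarrow> complex"

text \<open>\<open>op_bound X A C\<close> says that the operator norm of \<open>A\<close> is at most \<open>C\<close>, tested on the dense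
  subspace of finitely supported vectors.\<close>

definition op_bound :: "'a set \<Rightarrow> 'a mtx \<Rightarrow> real \<Rightarrow> bool" where
  "op_bound X A C \<longleftrightarrow> (\<forall>F u v. finite F \<longrightarrow> F \<subseteq> X \<longrightarrow>
     cmod (\<Sum>i\<in>F. \<Sum>j\<in>F. cnj (u i) * A i j * v j)
       \<le> C * L2_set (\<lambda>i. cmod (u i)) F * L2_set (\<lambda>j. cmod (v j)) F)"

definition bounded_ops :: "'a set \<Rightarrow> 'a mtx set" where
  "bounded_ops X = {A. (\<forall>i j. i \<notin> X \<or> j \<notin> X \<longrightarrow> A i j = 0) \<and> (\<exists>C. op_bound X A C)}"

definition op_zero :: "'a mtx" where
  "op_zero = (\<lambda>i j. 0)"

definition op_id :: "'a set \<Rightarrow> 'a mtx" where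
  "op_id X = (\<lambda>i j. if i = j \<and> i \<in> X then 1 else 0)"

definition op_add :: "'a mtx \<Rightarrow> 'a mtx \<Rightarrow> 'a mtx" where
  "op_add A B = (\<lambda>i j. A i j + B i j)"

definition op_diff :: "'a mtx \<Rightarrow> 'a mtx \<Rightarrow> 'a mtx" where
  "op_diff A B = (\<lambda>i j. A i j - B i j)"

definition op_scale :: "complex \<Rightarrow> 'a mtx \<Rightarrow> 'a mtx" where
  "op_scale c A = (\<lambda>i j. c * A i j)"

definition op_sum :: "('t \<Rightarrow> 'a mtx) \<Rightarrow> 't set \<Rightarrow> 'a mtx" where
  "op_sum f T = (\<lambda>i j. \<Sum>t\<in>T. f t i j)"

text \<open>For bounded operators the series is absolutely summable, by the Cauchy-Schwarz inequality.\<close>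

definition op_mult :: "'a set \<Rightarrow> 'a mtx \<Rightarrow> 'a mtx \<Rightarrow> 'a mtx" where
  "op_mult X A B = (\<lambda>i j. \<Sum>\<^sub>\<infinity>k\<in>X. A i k * B k j)"

definition op_adj :: "'a mtx \<Rightarrow> 'a mtx" where
  "op_adj A = (\<lambda>i j. cnj (A j i))"

definition op_tensor :: "'a mtx \<Rightarrow> 'b mtx \<Rightarrow> ('a \<times> 'b) mtx" where
  "op_tensor A B = (\<lambda>(i, j) (k, l). A i k * B j l)"

definition is_op_subspace :: "'a mtx set \<Rightarrow> bool" where
  "is_op_subspace S \<longleftrightarrow> op_zero \<in> S \<and> (\<forall>A\<in>S. \<forall>B\<in>S. op_add A B \<in> S) \<and>
     (\<forall>c. \<forall>A\<in>S. op_scale c A \<in> S)"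

definition op_span :: "'a mtx set \<Rightarrow> 'a mtx set" where
  "op_span T = {op_sum (\<lambda>A. op_scale (c A) A) F |c F. finite F \<and> F \<subseteq> T}"

text \<open>An operator space is a norm-closed linear subspace of the bounded operators.\<close>

definition operator_space :: "'a set \<Rightarrow> 'a mtx set \<Rightarrow> bool" where
  "operator_space X S \<longleftrightarrow> S \<subseteq> bounded_ops X \<and> is_op_subspace S \<and>
     (\<forall>A\<in>bounded_ops X. (\<forall>e>0. \<exists>B\<in>S. op_bound X (op_diff A B) e) \<longrightarrow> A \<in> S)"

definition commutant :: "'a set \<Rightarrow> 'a mtx set \<Rightarrow> 'a mtx set" where
  "commutant X M = {T \<in> bounded_ops X. \<forall>A\<in>M. op_mult X T A = op_mult X A T}"

definition von_neumann_algebra :: "'a set \<Rightarrow> 'a mtx set \<Rightarrow> bool" where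
  "von_neumann_algebra X M \<longleftrightarrow> M \<subseteq> bounded_ops X \<and> (\<forall>A\<in>M. op_adj A \<in> M) \<and>
     commutant X (commutant X M) = M"

text \<open>The von Neumann algebra tensor product is generated by the elementary tensors.\<close>

definition vn_tensor :: "'a set \<Rightarrow> 'a mtx set \<Rightarrow> 'b set \<Rightarrow> 'b mtx set \<Rightarrow> ('a \<times> 'b) mtx set" where
  "vn_tensor X M Y N = commutant (X \<times> Y) (commutant (X \<times> Y)
     {op_tensor A B |A B. A \<in> M \<and> B \<in> N})"

text \<open>A (finite, positive, faithful) trace on a \<open>*\<close>-algebra \<open>M\<close> of operators on \<open>\<ell>\<^sup>2(X)\<close>.\<close>

definition faithful_trace :: "'a set \<Rightarrow> 'a mtx set \<Rightarrow> ('a mtx \<Rightarrow> complex) \<Rightarrow> bool" where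
  "faithful_trace X M \<tau> \<longleftrightarrow>
     (\<forall>A\<in>M. \<forall>B\<in>M. \<tau> (op_add A B) = \<tau> A + \<tau> B) \<and>
     (\<forall>c. \<forall>A\<in>M. \<tau> (op_scale c A) = c * \<tau> A) \<and>
     (\<forall>A\<in>M. \<forall>B\<in>M. \<tau> (op_mult X A B) = \<tau> (op_mult X B A)) \<and>
     (\<forall>A\<in>M. \<tau> (op_mult X (op_adj A) A) \<in> \<real>\<^sub>\<ge>\<^sub>0) \<and>
     (\<forall>A\<in>M. \<tau> (op_mult X (op_adj A) A) = 0 \<longrightarrow> A = op_zero)"

definition faithful_tracial_state :: "'a set \<Rightarrow> 'a mtx set \<Rightarrow> ('a mtx \<Rightarrow> complex) \<Rightarrow> bool" where
  "faithful_tracial_state X M \<tau> \<longleftrightarrow> faithful_trace X M \<tau> \<and> \<tau> (op_id X) = 1"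

definition orth_complement ::
    "'a set \<Rightarrow> ('a mtx \<Rightarrow> complex) \<Rightarrow> 'a mtx set \<Rightarrow> 'a mtx set" where
  "orth_complement X \<tau> M = {A \<in> bounded_ops X. \<forall>B\<in>M. \<tau> (op_mult X (op_adj B) A) = 0}"

text \<open>The tuple \<open>(S, M, B(H))\<close> with \<open>H = \<ell>\<^sup>2(basis)\<close>.\<close>

record 'a qgraph =
  edge_space :: "'a mtx set"
  vertex_algebra :: "'a mtx set"
  basis :: "'a set"

text \<open>
  The Hilbert space is required to be nonzero.  No dimension is imposed on it directly, but the
  trace on \<open>B(H)\<close> defining the orthogonal complement is everywhere defined and faithful, and such
  a trace exists only in finite dimension; see \<open>finite_if_faithful_trace\<close> below.
\<close>

definition quantum_graph :: "'a qgraph \<Rightarrow> bool" where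
  "quantum_graph G \<longleftrightarrow>
     (let S = edge_space G; M = vertex_algebra G; X = basis G; M' = commutant X M in
        X \<noteq> {} \<and> von_neumann_algebra X M \<and> operator_space X S \<and>
        (\<forall>A\<in>S. op_adj A \<in> S) \<and>
        (\<forall>T\<in>M'. \<forall>A\<in>S. \<forall>R\<in>M'. op_mult X (op_mult X T A) R \<in> S) \<and>
        (\<exists>\<tau>. faithful_trace X (bounded_ops X) \<tau> \<and> S \<subseteq> orth_complement X \<tau> M'))"

text \<open>
  A finite-dimensional von Neumann algebra \<open>N\<close> is represented faithfully and unitally on some
  \<open>\<complex>\<^sup>k = \<ell>\<^sup>2({..<k})\<close>; every functional on it is then normal.  The state excludes \<open>N = 0\<close>.
\<close>

definition q_colourable :: "'a qgraph \<Rightarrow> nat \<Rightarrow> bool" where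
  "q_colourable G c \<longleftrightarrow>
     (let S = edge_space G; M = vertex_algebra G; X = basis G in
      \<exists>(k::nat) N \<tau> P.
        von_neumann_algebra {..<k} N \<and> faithful_tracial_state {..<k} N \<tau> \<and>
        (\<forall>a\<in>{1..c}. P a \<in> vn_tensor X M {..<k} N \<and>
           op_mult (X \<times> {..<k}) (P a) (P a) = P a \<and> op_adj (P a) = P a) \<and>
        op_sum P {1..c} = op_id (X \<times> {..<k}) \<and>
        (\<forall>a\<in>{1..c}. \<forall>A\<in>S.
           op_mult (X \<times> {..<k})
             (op_mult (X \<times> {..<k}) (P a) (op_tensor A (op_id {..<k}))) (P a) = op_zero))"

text \<open>The infimum of the empty set of extended naturals is \<open>\<infinity>\<close>.\<close>

definition chi_q :: "'a qgraph \<Rightarrow> enat" where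
  "chi_q G = Inf {enat c |c. q_colourable G c}"

text \<open>The tensor products and the sum of edge spaces are linear spans; for quantum graphs everything
  is finite-dimensional, so no closure has to be taken.\<close>

definition cartesian_product :: "'a qgraph \<Rightarrow> 'b qgraph \<Rightarrow> ('a \<times> 'b) qgraph"
    (infixl \<open>\<box>\<close> 70) where
  "G \<box> H = \<lparr>
     edge_space =
       {op_add A B |A B.
          A \<in> op_span {op_tensor T R |T R.
                 T \<in> edge_space G \<and> R \<in> commutant (basis H) (vertex_algebra H)} \<and>
          B \<in> op_span {op_tensor R T |R T.
                 R \<in> commutant (basis G) (vertex_algebra G) \<and> T \<in> edge_space H}},
     vertex_algebra = vn_tensor (basis G) (vertex_algebra G) (basis H) (vertex_algebra H),
     basis = basis G \<times> basis H\<rparr>"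


subsection \<open>A faithful trace on all bounded operators forces finite dimension\<close>

definition mtx_unit :: "'a \<Rightarrow> 'a \<Rightarrow> 'a mtx" where
  "mtx_unit a b = (\<lambda>i j. if i = a \<and> j = b then 1 else 0)"

lemma op_id_bounded:
  assumes "Y \<subseteq> X"
  shows "op_id Y \<in> bounded_ops X"
proof -
  have "op_bound X (op_id Y) 1"
    unfolding op_bound_def
  proof (intro allI impI)
    fix F and u v :: "'a \<Rightarrow> complex"
    assume F: "finite F" "F \<subseteq> X"
    have "(\<Sum>j\<in>F. cnj (u i) * op_id Y i j * v j) = (if i \<in> Y then cnj (u i) * v i else 0)"
      if "i \<in> F" for i
    proof -
      have "(\<Sum>j\<in>F. cnj (u i) * op_id Y i j * v j)
          = (\<Sum>j\<in>F. if i = j then (if i \<in> Y then cnj (u i) * v i else 0) else 0)"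
        by (rule sum.cong) (auto simp: op_id_def)
      then show ?thesis using F that by simp
    qed
    then have "cmod (\<Sum>i\<in>F. \<Sum>j\<in>F. cnj (u i) * op_id Y i j * v j)
        = cmod (\<Sum>i\<in>F. if i \<in> Y then cnj (u i) * v i else 0)"
      by simp
    also have "\<dots> \<le> (\<Sum>i\<in>F. \<bar>cmod (u i)\<bar> * \<bar>cmod (v i)\<bar>)"
      by (rule order_trans[OF norm_sum], rule sum_mono) (auto simp: norm_mult)
    also have "\<dots> \<le> L2_set (\<lambda>i. cmod (u i)) F * L2_set (\<lambda>j. cmod (v j)) F"
      by (rule L2_set_mult_ineq)
    finally show "cmod (\<Sum>i\<in>F. \<Sum>j\<in>F. cnj (u i) * op_id Y i j * v j)
       \<le> 1 * L2_set (\<lambda>i. cmod (u i)) F * L2_set (\<lambda>j. cmod (v j)) F"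
      by simp
  qed
  then show ?thesis
    using assms by (auto simp: bounded_ops_def op_id_def)
qed

lemma mtx_unit_bounded:
  assumes "a \<in> X" "b \<in> X"
  shows "mtx_unit a b \<in> bounded_ops X"
proof -
  have "op_bound X (mtx_unit a b) 1"
    unfolding op_bound_def
  proof (intro allI impI)
    fix F and u v :: "'a \<Rightarrow> complex"
    assume F: "finite F" "F \<subseteq> X"
    have "(\<Sum>i\<in>F. \<Sum>j\<in>F. cnj (u i) * mtx_unit a b i j * v j)
        = (\<Sum>i\<in>F. \<Sum>j\<in>F. if b = j then (if a = i then cnj (u a) * v b else 0) else 0)"
      by (intro sum.cong) (auto simp: mtx_unit_def)
    also have "\<dots> = (if a \<in> F \<and> b \<in> F then cnj (u a) * v b else 0)"
      using F by (cases "b \<in> F") simp_all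
    finally have eq: "(\<Sum>i\<in>F. \<Sum>j\<in>F. cnj (u i) * mtx_unit a b i j * v j)
        = (if a \<in> F \<and> b \<in> F then cnj (u a) * v b else 0)" .
    have "cmod (u a) * cmod (v b) \<le> L2_set (\<lambda>i. cmod (u i)) F * L2_set (\<lambda>j. cmod (v j)) F"
      if "a \<in> F" "b \<in> F"
      using member_le_L2_set[OF F(1) that(1), of "\<lambda>i. cmod (u i)"]
            member_le_L2_set[OF F(1) that(2), of "\<lambda>i. cmod (v i)"]
      by (intro mult_mono) auto
    then show "cmod (\<Sum>i\<in>F. \<Sum>j\<in>F. cnj (u i) * mtx_unit a b i j * v j)
       \<le> 1 * L2_set (\<lambda>i. cmod (u i)) F * L2_set (\<lambda>j. cmod (v j)) F"
      unfolding eq by (auto simp: norm_mult)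
  qed
  then show ?thesis
    using assms by (auto simp: bounded_ops_def mtx_unit_def)
qed

lemma op_id_idem:
  assumes "Y \<subseteq> X"
  shows "op_mult X (op_adj (op_id Y)) (op_id Y) = op_id Y"
proof (intro ext)
  fix i j
  have "op_mult X (op_adj (op_id Y)) (op_id Y) i j
      = (\<Sum>\<^sub>\<infinity>k\<in>{i} \<inter> X. op_adj (op_id Y) i k * op_id Y k j)"
    unfolding op_mult_def
    by (rule infsum_cong_neutral) (auto simp: op_id_def op_adj_def)
  then show "op_mult X (op_adj (op_id Y)) (op_id Y) i j = op_id Y i j"
    using assms by (cases "i \<in> X") (auto simp: op_id_def op_adj_def)
qed

lemma mtx_unit_mult:
  assumes "b \<in> X"
  shows "op_mult X (mtx_unit a b) (mtx_unit b a) = op_id {a}"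
proof (intro ext)
  fix i j
  have "op_mult X (mtx_unit a b) (mtx_unit b a) i j
      = (\<Sum>\<^sub>\<infinity>k\<in>{b}. mtx_unit a b i k * mtx_unit b a k j)"
    unfolding op_mult_def
    using assms by (intro infsum_cong_neutral) (auto simp: mtx_unit_def)
  then show "op_mult X (mtx_unit a b) (mtx_unit b a) i j = op_id {a} i j"
    by (auto simp: mtx_unit_def op_id_def)
qed

lemma finite_if_faithful_trace:
  assumes tr: "faithful_trace X (bounded_ops X) \<tau>"
  shows "finite X"
proof (rule ccontr)
  assume inf: "infinite X"
  then obtain x where x: "x \<in> X"
    using infinite_imp_nonempty by auto
  define t where "t = Re (\<tau> (op_id {x}))"
  have add: "\<tau> (op_id (Y \<union> Z)) = \<tau> (op_id Y) + \<tau> (op_id Z)"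
    if "Y \<subseteq> X" "Z \<subseteq> X" "Y \<inter> Z = {}" for Y Z
  proof -
    have "op_id (Y \<union> Z) = op_add (op_id Y) (op_id Z)"
      using that by (auto simp: op_add_def op_id_def fun_eq_iff)
    then show ?thesis
      using tr op_id_bounded that unfolding faithful_trace_def by metis
  qed
  have pos: "\<tau> (op_id Y) \<in> \<real>\<^sub>\<ge>\<^sub>0" if "Y \<subseteq> X" for Y
    using tr op_id_bounded[OF that] op_id_idem[OF that]
    unfolding faithful_trace_def by metis
  have eq: "\<tau> (op_id {y}) = \<tau> (op_id {x})" if "y \<in> X" for y
    using tr mtx_unit_bounded[OF x that] mtx_unit_bounded[OF that x]
      mtx_unit_mult[OF x, of y] mtx_unit_mult[OF that, of x]
    unfolding faithful_trace_def by metis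
  have "\<tau> (op_id {x}) \<noteq> 0"
  proof
    assume "\<tau> (op_id {x}) = 0"
    then have "op_id {x} = op_zero"
      using tr x op_id_bounded[of "{x}" X] op_id_idem[of "{x}" X]
      unfolding faithful_trace_def by auto
    then have "op_id {x} x x = op_zero x x" by simp
    then show False by (simp add: op_id_def op_zero_def)
  qed
  then have t: "t > 0"
    using pos[of "{x}"] x unfolding t_def
    by (auto simp: complex_nonneg_Reals_iff complex_eq_iff less_le)
  have card: "Re (\<tau> (op_id F)) \<ge> real (card F) * t" if "finite F" "F \<subseteq> X" for F
    using that
  proof (induction F rule: finite_induct)
    case empty
    then show ?case using pos[of "{}"] by (simp add: complex_nonneg_Reals_iff)
  next
    case (insert y F)
    then show ?case
      using add[of "{y}" F] eq[of y] by (simp add: t_def algebra_simps)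
  qed
  obtain n :: nat where n: "real n * t > Re (\<tau> (op_id X))"
    using t reals_Archimedean3 by blast
  obtain F where F: "finite F" "card F = n" "F \<subseteq> X"
    using infinite_arbitrarily_large[OF inf] by blast
  have "\<tau> (op_id X) = \<tau> (op_id F) + \<tau> (op_id (X - F))"
    using add[of F "X - F"] F by (simp add: Un_absorb1)
  moreover have "Re (\<tau> (op_id (X - F))) \<ge> 0"
    using pos[of "X - F"] by (simp add: complex_nonneg_Reals_iff)
  ultimately show False
    using card[OF F(1,3)] F(2) n by simp
qed

end

theory Submission
  imports Defs
begin

text \<open>
  Let \<open>P\<^sub>1, \<dots>, P\<^sub>c\<close> colour \<open>G \<box> H\<close> with auxiliary algebra \<open>N\<close> on \<open>\<complex>\<^sup>k\<close>.  The same projections colour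
  \<open>G\<close> once \<open>H\<close>'s Hilbert space is moved into the auxiliary one, because \<open>T \<otimes> 1\<close> is an edge operator
  of \<open>G \<box> H\<close> for every edge operator \<open>T\<close> of \<open>G\<close>.  Instead of \<open>M\<^sub>H \<otimes> N\<close> the full matrix algebra
  on \<open>H \<otimes> \<complex>\<^sup>k\<close> serves as the new auxiliary algebra: it carries the normalised matrix trace, and the
  commutant of \<open>M\<^sub>G \<otimes> B(H \<otimes> \<complex>\<^sup>k)\<close> is simply \<open>M\<^sub>G' \<otimes> 1\<close>, which commutes with the \<open>P\<^sub>a\<close>.
\<close>

section \<open>Operators over a finite index set\<close>

text \<open>The sum of the moduli of all entries is a norm bound, so over a finite index set only
  the support condition in \<open>bounded_ops\<close> remains to be checked.\<close>

lemma bounded_ops_finite: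
  assumes "finite X"
  shows "A \<in> bounded_ops X \<longleftrightarrow> (\<forall>i j. i \<notin> X \<or> j \<notin> X \<longrightarrow> A i j = 0)"
proof -
  have "op_bound X A (\<Sum>i\<in>X. \<Sum>j\<in>X. cmod (A i j))"
    unfolding op_bound_def
  proof (intro allI impI)
    fix F and u v :: "'a \<Rightarrow> complex"
    assume F: "finite F" "F \<subseteq> X"
    let ?u = "L2_set (\<lambda>i. cmod (u i)) F" and ?v = "L2_set (\<lambda>i. cmod (v i)) F"
    have "cmod (\<Sum>i\<in>F. \<Sum>j\<in>F. cnj (u i) * A i j * v j)
        \<le> (\<Sum>i\<in>F. \<Sum>j\<in>F. cmod (cnj (u i) * A i j * v j))"
      by (intro order_trans[OF norm_sum] sum_mono norm_sum)
    also have "\<dots> \<le> (\<Sum>i\<in>F. \<Sum>j\<in>F. cmod (A i j) * (?u * ?v))"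
    proof (intro sum_mono)
      fix i j assume "i \<in> F" "j \<in> F"
      then have "cmod (u i) * cmod (v j) \<le> ?u * ?v"
        using member_le_L2_set[OF F(1), of i "\<lambda>i. cmod (u i)"]
              member_le_L2_set[OF F(1), of j "\<lambda>i. cmod (v i)"]
        by (intro mult_mono) auto
      then have "cmod (A i j) * (cmod (u i) * cmod (v j)) \<le> cmod (A i j) * (?u * ?v)"
        by (intro mult_left_mono) auto
      then show "cmod (cnj (u i) * A i j * v j) \<le> cmod (A i j) * (?u * ?v)"
        by (simp add: norm_mult mult_ac)
    qed
    also have "\<dots> = (\<Sum>i\<in>F. \<Sum>j\<in>F. cmod (A i j)) * (?u * ?v)"
      by (simp add: sum_distrib_right)
    also have "\<dots> \<le> (\<Sum>i\<in>X. \<Sum>j\<in>X. cmod (A i j)) * (?u * ?v)"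
    proof (rule mult_right_mono)
      have "(\<Sum>i\<in>F. \<Sum>j\<in>F. cmod (A i j)) \<le> (\<Sum>i\<in>F. \<Sum>j\<in>X. cmod (A i j))"
        using F assms by (intro sum_mono sum_mono2) auto
      also have "\<dots> \<le> (\<Sum>i\<in>X. \<Sum>j\<in>X. cmod (A i j))"
        using F assms by (intro sum_mono2) (auto intro: sum_nonneg)
      finally show "(\<Sum>i\<in>F. \<Sum>j\<in>F. cmod (A i j)) \<le> (\<Sum>i\<in>X. \<Sum>j\<in>X. cmod (A i j))" .
    qed (simp add: L2_set_nonneg)
    finally show "cmod (\<Sum>i\<in>F. \<Sum>j\<in>F. cnj (u i) * A i j * v j)
        \<le> (\<Sum>i\<in>X. \<Sum>j\<in>X. cmod (A i j)) * ?u * ?v"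
      by (simp add: mult.assoc)
  qed
  then show ?thesis
    unfolding bounded_ops_def by auto
qed

lemma op_mult_finite:
  assumes "finite X"
  shows "op_mult X A B i j = (\<Sum>k\<in>X. A i k * B k j)"
  using assms by (simp add: op_mult_def)

lemma op_mult_id_left:
  assumes "finite X" "A \<in> bounded_ops X"
  shows "op_mult X (op_id X) A = A"
proof (intro ext)
  fix i j
  have "op_mult X (op_id X) A i j = (\<Sum>k\<in>X. if i = k then A i j else 0)"
    unfolding op_mult_finite[OF assms(1)] by (rule sum.cong) (auto simp: op_id_def)
  then show "op_mult X (op_id X) A i j = A i j"
    using assms by (auto simp: bounded_ops_finite)
qed

lemma op_mult_id_right:
  assumes "finite X" "A \<in> bounded_ops X"
  shows "op_mult X A (op_id X) = A"
proof (intro ext)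
  fix i j
  have "op_mult X A (op_id X) i j = (\<Sum>k\<in>X. if k = j then A i j else 0)"
    unfolding op_mult_finite[OF assms(1)] by (rule sum.cong) (auto simp: op_id_def)
  then show "op_mult X A (op_id X) i j = A i j"
    using assms by (auto simp: bounded_ops_finite)
qed

lemma op_tensor_mult:
  assumes "finite X" "finite Y"
  shows "op_mult (X \<times> Y) (op_tensor A B) (op_tensor C D)
    = op_tensor (op_mult X A C) (op_mult Y B D)"
proof -
  have "(\<Sum>p\<in>X \<times> Y. op_tensor A B (i, j) p * op_tensor C D p (k, l))
      = (\<Sum>x\<in>X. A i x * C x k) * (\<Sum>y\<in>Y. B j y * D y l)" for i j k l
    unfolding sum_product sum.cartesian_product
    by (rule sum.cong) (auto simp: op_tensor_def)
  then show ?thesis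
    using assms by (auto simp: fun_eq_iff op_mult_finite op_tensor_def)
qed

lemma op_tensor_bounded:
  assumes "finite X" "finite Y" "A \<in> bounded_ops X" "B \<in> bounded_ops Y"
  shows "op_tensor A B \<in> bounded_ops (X \<times> Y)"
  using assms by (auto simp: bounded_ops_finite op_tensor_def)

section \<open>Commutants and the full matrix algebra\<close>

lemma op_zero_commutant: "op_zero \<in> commutant X M"
proof -
  have "op_bound X op_zero 0"
    by (simp add: op_bound_def op_zero_def)
  then have "op_zero \<in> bounded_ops X"
    by (auto simp: bounded_ops_def op_zero_def)
  then show ?thesis
    by (simp add: commutant_def op_mult_def op_zero_def)
qed

lemma op_id_commutant:
  assumes "finite X" "M \<subseteq> bounded_ops X"
  shows "op_id X \<in> commutant X M"
  using assms
  by (auto simp: commutant_def op_mult_id_left op_mult_id_right op_id_bounded subset_iff)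

lemma subset_bicommutant:
  assumes "M \<subseteq> bounded_ops X"
  shows "M \<subseteq> commutant X (commutant X M)"
  using assms by (auto simp: commutant_def subset_iff)

text \<open>The double commutant contains the family it starts from and consists of bounded
  operators, so here it is squeezed to equality.\<close>

lemma bounded_ops_von_neumann:
  assumes "finite X"
  shows "von_neumann_algebra X (bounded_ops X)"
  unfolding von_neumann_algebra_def
  using assms subset_bicommutant[of "bounded_ops X" X]
  by (auto simp: bounded_ops_finite op_adj_def commutant_def)

text \<open>The trace of \<open>op_mult X (op_adj A) A\<close> is, up to the factor
  \<open>1 / card X\<close>, the squared Frobenius norm of \<open>A\<close>; positivity and
  faithfulness both follow.\<close>

lemma normalised_trace_faithful:
  assumes "finite X" "X \<noteq> {}"
  shows "faithful_tracial_state X (bounded_ops X) (\<lambda>A. (\<Sum>i\<in>X. A i i) / of_nat (card X))"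
proof -
  define n :: complex where "n = of_nat (card X)"
  have n: "n \<noteq> 0"
    using assms by (simp add: n_def)
  have norm_sq: "(\<Sum>i\<in>X. op_mult X (op_adj A) A i i)
      = complex_of_real (\<Sum>i\<in>X. \<Sum>k\<in>X. (cmod (A k i))\<^sup>2)" for A
    using assms(1)
    by (simp add: op_mult_finite op_adj_def complex_norm_square[symmetric] mult.commute[of "cnj _"])
  have cyclic: "(\<Sum>i\<in>X. op_mult X A B i i) = (\<Sum>i\<in>X. op_mult X B A i i)" for A B
    using assms(1) by (simp add: op_mult_finite) (subst sum.swap, simp add: mult.commute)
  have pos: "(\<Sum>i\<in>X. op_mult X (op_adj A) A i i) / n \<in> \<real>\<^sub>\<ge>\<^sub>0" for A
  proof -
    have "(\<Sum>i\<in>X. op_mult X (op_adj A) A i i) / n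
        = complex_of_real ((\<Sum>i\<in>X. \<Sum>k\<in>X. (cmod (A k i))\<^sup>2) / real (card X))"
      unfolding norm_sq n_def by simp
    moreover have "0 \<le> (\<Sum>i\<in>X. \<Sum>k\<in>X. (cmod (A k i))\<^sup>2) / real (card X)"
      by (intro divide_nonneg_nonneg sum_nonneg) auto
    ultimately show ?thesis
      by (simp only: nonneg_Reals_of_real_iff)
  qed
  have faithful: "A = op_zero"
    if A: "A \<in> bounded_ops X" and zero: "(\<Sum>i\<in>X. op_mult X (op_adj A) A i i) / n = 0" for A
  proof -
    have "(\<Sum>i\<in>X. \<Sum>k\<in>X. (cmod (A k i))\<^sup>2) = 0"
      using zero n unfolding norm_sq by (simp del: of_real_sum)
    then have "\<forall>i\<in>X. \<forall>k\<in>X. A k i = 0"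
      using assms(1) by (simp add: sum_nonneg_eq_0_iff sum_nonneg)
    then show ?thesis
      using A assms(1) by (fastforce simp: bounded_ops_finite op_zero_def)
  qed
  have "(\<Sum>i\<in>X. op_id X i i) / n = 1"
    using n by (simp add: op_id_def n_def)
  moreover have "faithful_trace X (bounded_ops X) (\<lambda>A. (\<Sum>i\<in>X. A i i) / n)"
    unfolding faithful_trace_def
    using cyclic pos faithful
    by (auto simp: op_add_def op_scale_def sum.distrib add_divide_distrib
        sum_distrib_left[symmetric])
  ultimately show ?thesis
    by (simp add: faithful_tracial_state_def n_def)
qed

section \<open>The commutant of a tensor product with a full matrix algebra\<close>

text \<open>View \<open>T\<close> as a matrix of blocks indexed by \<open>Z\<close>. Commuting with
  1 \<otimes> E for all matrix units E makes it block diagonal with equal blocks; commuting with A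
  \<otimes> 1 puts the common block in the commutant of \<open>M\<close>.\<close>

lemma commutant_tensor_bounded_ops:
  fixes X :: "'a set" and Z :: "'b set"
  assumes fin: "finite X" "finite Z" and z: "z \<in> Z"
    and M: "op_id X \<in> M" "M \<subseteq> bounded_ops X"
    and T: "T \<in> commutant (X \<times> Z) {op_tensor A D |A D. A \<in> M \<and> D \<in> bounded_ops Z}"
  obtains R where "R \<in> commutant X M" "T = op_tensor R (op_id Z)"
proof -
  \<comment> \<open>The diagonal block at the reference index \<open>z\<close>, with which all other
    blocks are compared.\<close>
  define R where "R = (\<lambda>x y. T (x, z) (y, z))"
  have T_bounded: "T \<in> bounded_ops (X \<times> Z)"
    using T by (simp add: commutant_def)
  have comm: "op_mult (X \<times> Z) T (op_tensor A D) = op_mult (X \<times> Z) (op_tensor A D) T"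
    if "A \<in> M" "D \<in> bounded_ops Z" for A D
    using T that unfolding commutant_def by blast
  have entry: "T (x, a) (y, b) = (if a = b then R x y else 0)"
    if x: "x \<in> X" "y \<in> X" and a: "a \<in> Z" "b \<in> Z" for x y a b
  proof -
    \<comment> \<open>In the block at \<open>(a, z)\<close>, multiplying \<open>T\<close> by
      \<open>?E\<close> on the right selects the block \<open>(a, b)\<close> of \<open>T\<close>,
      while multiplying on the left selects the block \<open>(z, z)\<close> if \<open>a = b\<close>
      and 0 otherwise.\<close>
    let ?E = "op_tensor (op_id X) (mtx_unit b z)"
    have "op_mult (X \<times> Z) T ?E (x, a) (y, z)
        = (\<Sum>p\<in>X \<times> Z. if p = (y, b) then T (x, a) (y, b) else 0)"
      unfolding op_mult_finite[OF finite_cartesian_product[OF fin]] using x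
      by (intro sum.cong) (auto simp: op_tensor_def op_id_def mtx_unit_def split: if_splits)
    then have "op_mult (X \<times> Z) T ?E (x, a) (y, z) = T (x, a) (y, b)"
      using fin x a by simp
    moreover have "op_mult (X \<times> Z) ?E T (x, a) (y, z)
        = (\<Sum>p\<in>X \<times> Z. if p = (x, z) then (if a = b then R x y else 0) else 0)"
      unfolding op_mult_finite[OF finite_cartesian_product[OF fin]] using x
      by (intro sum.cong) (auto simp: op_tensor_def op_id_def mtx_unit_def R_def split: if_splits)
    then have "op_mult (X \<times> Z) ?E T (x, a) (y, z) = (if a = b then R x y else 0)"
      using fin x z by simp
    ultimately show ?thesis
      using comm[OF M(1) mtx_unit_bounded[OF a(2) z]] by simp
  qed
  have R_bounded: "R \<in> bounded_ops X"
    using T_bounded fin by (auto simp: R_def bounded_ops_finite)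
  have T_eq: "T = op_tensor R (op_id Z)"
  proof (intro ext)
    fix p q :: "'a \<times> 'b"
    obtain x a y b where pq: "p = (x, a)" "q = (y, b)"
      by (cases p; cases q)
    show "T p q = op_tensor R (op_id Z) p q"
    proof (cases "x \<in> X \<and> y \<in> X \<and> a \<in> Z \<and> b \<in> Z")
      case True
      then show ?thesis
        by (simp add: pq entry op_tensor_def op_id_def)
    next
      case False
      then have "T p q = 0"
        using T_bounded fin by (auto simp: pq bounded_ops_finite)
      moreover have "op_tensor R (op_id Z) p q = 0"
        using False R_bounded fin by (auto simp: pq bounded_ops_finite op_tensor_def op_id_def)
      ultimately show ?thesis by simp
    qed
  qed
  have "op_mult X R A = op_mult X A R" if A: "A \<in> M" for A
  proof -
    have Id: "op_id Z \<in> bounded_ops Z"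
      by (simp add: op_id_bounded)
    have "op_tensor (op_mult X R A) (op_id Z) = op_tensor (op_mult X A R) (op_id Z)"
      using comm[OF A Id] fin
      by (simp add: T_eq op_tensor_mult op_mult_id_left[OF _ Id])
    \<comment> \<open>The block at \<open>(z, z)\<close> recovers the first tensor factor, since
      \<open>op_id Z z z = 1\<close>.\<close>
    then have "op_tensor (op_mult X R A) (op_id Z) (x, z) (y, z)
        = op_tensor (op_mult X A R) (op_id Z) (x, z) (y, z)" for x y
      by simp
    then show ?thesis
      using z by (simp add: op_tensor_def op_id_def fun_eq_iff)
  qed
  then have "R \<in> commutant X M"
    using R_bounded by (simp add: commutant_def)
  with T_eq show thesis
    using that by blast
qed

section \<open>Transport of operators along a bijection\<close>

text \<open>For a bijection \<open>g\<close> this is conjugation by the unitary that relabels the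
  basis. It is needed because \<open>q_colourable\<close> wants the auxiliary space indexed by an
  initial segment of the naturals. The cut-off keeps coefficients zero outside
  \<open>Z\<close>.\<close>

definition op_pull :: "'a set \<Rightarrow> ('a \<Rightarrow> 'b) \<Rightarrow> 'b mtx \<Rightarrow> 'a mtx" where
  "op_pull Z g A = (\<lambda>i j. if i \<in> Z \<and> j \<in> Z then A (g i) (g j) else 0)"

lemma op_pull_mult:
  assumes "bij_betw g Z W"
  shows "op_mult Z (op_pull Z g A) (op_pull Z g B) = op_pull Z g (op_mult W A B)"
proof (intro ext)
  fix i j
  show "op_mult Z (op_pull Z g A) (op_pull Z g B) i j = op_pull Z g (op_mult W A B) i j"
  proof (cases "i \<in> Z \<and> j \<in> Z")
    case True
    have "(\<Sum>\<^sub>\<infinity>k\<in>Z. op_pull Z g A i k * op_pull Z g B k j)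
        = (\<Sum>\<^sub>\<infinity>k\<in>Z. A (g i) (g k) * B (g k) (g j))"
      using True by (intro infsum_cong) (simp add: op_pull_def)
    also have "\<dots> = (\<Sum>\<^sub>\<infinity>k\<in>W. A (g i) k * B k (g j))"
      using assms by (rule infsum_reindex_bij_betw)
    finally show ?thesis
      using True by (simp add: op_mult_def op_pull_def)
  qed (auto simp: op_mult_def op_pull_def)
qed

lemma op_pull_id:
  assumes "bij_betw g Z W"
  shows "op_pull Z g (op_id W) = op_id Z"
proof -
  have "g i \<in> W" "g i = g j \<longleftrightarrow> i = j" if "i \<in> Z" "j \<in> Z" for i j
    using assms that by (auto simp: bij_betw_def inj_on_eq_iff)
  then show ?thesis
    by (auto simp: op_pull_def op_id_def fun_eq_iff)
qed

text \<open>\<open>T'\<close> is the operator \<open>T \<otimes> 1\<close> on \<open>\<ell>\<^sup>2(X \<times> Y)\<close>, transported along the bijection \<open>h\<close>.\<close>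

definition ampliation :: "('a \<times> 'b \<Rightarrow> 'c) \<Rightarrow> 'a set \<Rightarrow> 'b set \<Rightarrow> 'a mtx \<Rightarrow> 'c mtx \<Rightarrow> bool" where
  "ampliation h X Y T T' \<longleftrightarrow> op_pull (X \<times> Y) h T' = op_tensor T (op_id Y)"

section \<open>Transfer of colourings along ampliations\<close>

text \<open>Stated for a general bijection \<open>h\<close> so that one argument serves both factors
  of the product. The ampliated edges carry over the vanishing condition, and the ampliated
  commutant shows that the transported projections lie in the new tensor product.\<close>

lemma q_colourable_ampliation:
  fixes G :: "'a qgraph" and K :: "'c qgraph" and h :: "'a \<times> 'b \<Rightarrow> 'c" and Y :: "'b set"
  defines "X \<equiv> basis G" and "Z \<equiv> basis K"
  assumes fin: "finite X" "finite Y" and Y: "Y \<noteq> {}" and h: "bij_betw h (X \<times> Y) Z"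
    and vN: "von_neumann_algebra X (vertex_algebra G)" and S: "edge_space G \<subseteq> bounded_ops X"
    and edge: "\<And>T. T \<in> edge_space G \<Longrightarrow> \<exists>T'\<in>edge_space K. ampliation h X Y T T'"
    and comm: "\<And>T. T \<in> commutant X (vertex_algebra G) \<Longrightarrow>
      \<exists>T'\<in>commutant Z (vertex_algebra K). ampliation h X Y T T'"
    and K: "q_colourable K c"
  shows "q_colourable G c"
proof -
  let ?M = "vertex_algebra G"
  obtain k :: nat and N \<tau> P where
    N: "von_neumann_algebra {..<k} N" and \<tau>: "faithful_tracial_state {..<k} N \<tau>"
    and P: "\<And>a. a \<in> {1..c} \<Longrightarrow> P a \<in> vn_tensor Z (vertex_algebra K) {..<k} N"
    and P_idem: "\<And>a. a \<in> {1..c} \<Longrightarrow> op_mult (Z \<times> {..<k}) (P a) (P a) = P a"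
    and P_adj: "\<And>a. a \<in> {1..c} \<Longrightarrow> op_adj (P a) = P a"
    and P_sum: "op_sum P {1..c} = op_id (Z \<times> {..<k})"
    and P_edge: "\<And>a A. a \<in> {1..c} \<Longrightarrow> A \<in> edge_space K \<Longrightarrow>
      op_mult (Z \<times> {..<k})
        (op_mult (Z \<times> {..<k}) (P a) (op_tensor A (op_id {..<k}))) (P a) = op_zero"
    using K unfolding q_colourable_def Let_def Z_def by metis
  have finZ: "finite Z"
    using bij_betw_finite[OF h] fin by simp
  have N_bounded: "N \<subseteq> bounded_ops {..<k}"
    using N by (simp add: von_neumann_algebra_def)
  \<comment> \<open>The state rules out \<open>k = 0\<close>: there the identity is the zero
    operator, whose value under \<open>\<tau>\<close> would be 0 instead of 1. \<open>N\<close>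
    contains zero because it is itself a commutant.\<close>
  have "op_zero \<in> N"
    using N op_zero_commutant unfolding von_neumann_algebra_def by metis
  then have "\<tau> (op_scale 0 op_zero) = 0"
    using \<tau> unfolding faithful_tracial_state_def faithful_trace_def by (metis mult_zero_left)
  moreover have "op_scale 0 op_zero = op_id {..<k}" if "k = 0"
    using that by (simp add: op_scale_def op_id_def)
  ultimately have k: "k > 0"
    using \<tau> unfolding faithful_tracial_state_def by (metis gr0I zero_neq_one)

  \<comment> \<open>The dimension of the new auxiliary space, the tensor product of the space over
    \<open>Y\<close> with the old one; \<open>e\<close> numbers its basis.\<close>
  define n where "n = card (Y \<times> {..<k})"
  have n: "0 < n"
    using fin Y k by (auto simp: n_def card_gt_0_iff)
  obtain e where "bij_betw e {0..<n} (Y \<times> {..<k})"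
    using ex_bij_betw_nat_finite[of "Y \<times> {..<k}"] fin unfolding n_def by auto
  then have e: "bij_betw e {..<n} (Y \<times> {..<k})"
    by (simp add: atLeast0LessThan)
  \<comment> \<open>Decode \<open>i\<close> into a pair in \<open>Y \<times> {..<k}\<close>, regroup
    the \<open>Y\<close> coordinate with \<open>x\<close>, then apply \<open>h\<close>.\<close>
  define g where "g = (\<lambda>(x, i). (h (x, fst (e i)), snd (e i)))"
  let ?W = "X \<times> {..<n}" and ?V = "Z \<times> {..<k}"
  have g: "bij_betw g ?W ?V"
  proof -
    have "bij_betw (map_prod id e) ?W (X \<times> (Y \<times> {..<k}))"
      using e by (intro bij_betw_map_prod) auto
    moreover have "bij_betw (\<lambda>(x, (y, s)). ((x, y), s)) (X \<times> (Y \<times> {..<k})) ((X \<times> Y) \<times> {..<k})"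
      by (rule bij_betw_byWitness[where f' = "\<lambda>((x, y), s). (x, (y, s))"]) auto
    moreover have "bij_betw (map_prod h id) ((X \<times> Y) \<times> {..<k}) ?V"
      using h by (intro bij_betw_map_prod) auto
    ultimately have "bij_betw (map_prod h id \<circ> ((\<lambda>(x, (y, s)). ((x, y), s)) \<circ> map_prod id e)) ?W ?V"
      by (intro bij_betw_trans)
    moreover have "map_prod h id \<circ> ((\<lambda>(x, (y, s)). ((x, y), s)) \<circ> map_prod id e) = g"
      by (auto simp: g_def fun_eq_iff split_beta)
    ultimately show ?thesis by simp
  qed
  have pull_ampliation: "op_pull ?W g (op_tensor T' (op_id {..<k})) = op_tensor T (op_id {..<n})"
    if T: "T \<in> bounded_ops X" and amp: "ampliation h X Y T T'" for T T'
  proof (intro ext)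
    fix p q :: "'a \<times> nat"
    obtain x i y j where pq: "p = (x, i)" "q = (y, j)"
      by (cases p; cases q)
    show "op_pull ?W g (op_tensor T' (op_id {..<k})) p q = op_tensor T (op_id {..<n}) p q"
    proof (cases "x \<in> X \<and> y \<in> X \<and> i < n \<and> j < n")
      case True
      have ei: "fst (e i) \<in> Y" "snd (e i) < k" "fst (e j) \<in> Y" "snd (e j) < k"
        using True bij_betwE[OF e] by (auto simp: mem_Times_iff)
      \<comment> \<open>The identities over \<open>Y\<close> and \<open>{..<k}\<close> together test
        whether both components of \<open>e i\<close> and \<open>e j\<close> agree, which by
        injectivity is the identity over \<open>{..<n}\<close>.\<close>
      have "e i = e j \<longleftrightarrow> i = j"
        using True e by (auto simp: bij_betw_def inj_on_eq_iff)
      moreover have "T' (h (x, fst (e i))) (h (y, fst (e j)))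
          = op_tensor T (op_id Y) (x, fst (e i)) (y, fst (e j))"
        using fun_cong[OF fun_cong[OF amp[unfolded ampliation_def],
              of "(x, fst (e i))"], of "(y, fst (e j))"] True ei
        by (simp add: op_pull_def)
      ultimately show ?thesis
        using True ei by (auto simp: pq op_pull_def g_def op_tensor_def op_id_def prod_eq_iff)
    next
      case False
      then show ?thesis
        using T fin by (auto simp: pq op_pull_def op_tensor_def op_id_def bounded_ops_finite)
    qed
  qed
  \<comment> \<open>The identity lies in \<open>?M\<close> because \<open>?M\<close> is the
    commutant of its own commutant.\<close>
  have M: "op_id X \<in> ?M" "?M \<subseteq> bounded_ops X"
    using vN op_id_commutant[OF fin(1), of "commutant X ?M"]
    by (auto simp: von_neumann_algebra_def commutant_def)
  define P' where "P' = (\<lambda>a. op_pull ?W g (P a))"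

  have P'_mem: "P' a \<in> vn_tensor X ?M {..<n} (bounded_ops {..<n})" if a: "a \<in> {1..c}" for a
  proof -
    \<comment> \<open>Membership in a double commutant is tested against each \<open>T\<close>
      commuting with the generators. Such a \<open>T\<close> is R \<otimes> 1, the pull-back of R'
      \<otimes> 1, and the latter commutes with the generators of the algebra containing
      \<open>P a\<close>, hence with \<open>P a\<close>.\<close>
    have "op_mult ?W (P' a) T = op_mult ?W T (P' a)"
      if T: "T \<in> commutant ?W {op_tensor A D |A D. A \<in> ?M \<and> D \<in> bounded_ops {..<n}}" for T
    proof -
      obtain R where R: "R \<in> commutant X ?M" "T = op_tensor R (op_id {..<n})"
        using commutant_tensor_bounded_ops[OF fin(1) _ _ M T, of 0] n by auto
      obtain R' where R': "R' \<in> commutant Z (vertex_algebra K)" "ampliation h X Y R R'"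
        using comm[OF R(1)] by auto
      have "op_tensor R' (op_id {..<k})
          \<in> commutant ?V {op_tensor A B |A B. A \<in> vertex_algebra K \<and> B \<in> N}"
        using R'(1) N_bounded finZ
        by (auto simp: commutant_def op_tensor_bounded op_id_bounded op_tensor_mult
            op_mult_id_left op_mult_id_right subset_iff)
      then have "op_mult ?V (P a) (op_tensor R' (op_id {..<k}))
          = op_mult ?V (op_tensor R' (op_id {..<k})) (P a)"
        using P[OF a] unfolding vn_tensor_def commutant_def by blast
      then have "op_mult ?W (P' a) (op_pull ?W g (op_tensor R' (op_id {..<k})))
          = op_mult ?W (op_pull ?W g (op_tensor R' (op_id {..<k}))) (P' a)"
        by (simp add: P'_def op_pull_mult[OF g])
      moreover have "op_pull ?W g (op_tensor R' (op_id {..<k})) = T"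
        using pull_ampliation R R'(2) by (simp add: commutant_def)
      ultimately show ?thesis by simp
    qed
    moreover have "P' a \<in> bounded_ops ?W"
      using fin(1) by (auto simp: P'_def op_pull_def bounded_ops_finite)
    ultimately show ?thesis
      by (simp add: vn_tensor_def commutant_def[of ?W "commutant ?W _"])
  qed
  have P'_edge: "op_mult ?W (op_mult ?W (P' a) (op_tensor A (op_id {..<n}))) (P' a) = op_zero"
    if a: "a \<in> {1..c}" and A: "A \<in> edge_space G" for a A
  proof -
    obtain A' where A': "A' \<in> edge_space K" "ampliation h X Y A A'"
      using edge[OF A] by auto
    have "op_tensor A (op_id {..<n}) = op_pull ?W g (op_tensor A' (op_id {..<k}))"
      using pull_ampliation A S A'(2) by auto
    then have "op_mult ?W (op_mult ?W (P' a) (op_tensor A (op_id {..<n}))) (P' a)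
        = op_pull ?W g (op_mult ?V (op_mult ?V (P a) (op_tensor A' (op_id {..<k}))) (P a))"
      by (simp add: P'_def op_pull_mult[OF g])
    also have "\<dots> = op_zero"
      unfolding P_edge[OF a A'(1)] by (auto simp: op_pull_def op_zero_def fun_eq_iff)
    finally show ?thesis .
  qed
  have P'_idem: "op_mult ?W (P' a) (P' a) = P' a" if "a \<in> {1..c}" for a
    using P_idem[OF that] by (simp add: P'_def op_pull_mult[OF g])
  have P'_adj: "op_adj (P' a) = P' a" if "a \<in> {1..c}" for a
  proof -
    have "op_adj (P' a) = op_pull ?W g (op_adj (P a))"
      by (auto simp: P'_def op_adj_def op_pull_def fun_eq_iff)
    then show ?thesis
      using P_adj[OF that] by (simp add: P'_def)
  qed
  have "op_sum P' {1..c} = op_pull ?W g (op_sum P {1..c})"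
    by (auto simp: P'_def op_sum_def op_pull_def fun_eq_iff)
  then have P'_sum: "op_sum P' {1..c} = op_id ?W"
    by (simp only: P_sum op_pull_id[OF g])
  \<comment> \<open>Keeping \<open>card {..<n}\<close> unevaluated leaves the trace in the form
    given by \<open>normalised_trace_faithful\<close>.\<close>
  show ?thesis
    unfolding q_colourable_def Let_def X_def[symmetric]
    using bounded_ops_von_neumann[of "{..<n}"] normalised_trace_faithful[of "{..<n}"] n
      P'_mem P'_edge P'_idem P'_adj P'_sum
    by (intro exI[of _ n] exI[of _ "bounded_ops {..<n}"]
        exI[of _ "\<lambda>A. (\<Sum>i<n. A i i) / of_nat (card {..<n})"] exI[of _ P'])
      (auto simp del: card_lessThan)
qed

section \<open>Quantum graphs and their Cartesian product\<close>

text \<open>Finiteness comes from the faithful trace on all of B(H), by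
  \<open>finite_if_faithful_trace\<close>; it turns the series in \<open>op_mult\<close> into finite
  sums.\<close>

lemma quantum_graphD:
  assumes "quantum_graph G"
  shows "finite (basis G)" "basis G \<noteq> {}" "von_neumann_algebra (basis G) (vertex_algebra G)"
    "edge_space G \<subseteq> bounded_ops (basis G)" "vertex_algebra G \<subseteq> bounded_ops (basis G)"
  using assms finite_if_faithful_trace
  by (auto simp: quantum_graph_def Let_def operator_space_def von_neumann_algebra_def)

lemma op_span_base:
  assumes "A \<in> T"
  shows "A \<in> op_span T"
proof -
  have "A = op_sum (\<lambda>B. op_scale 1 B) {A}"
    by (simp add: op_sum_def op_scale_def)
  then show ?thesis
    unfolding op_span_def using assms
    by (intro CollectI exI[of _ "\<lambda>_. 1"] exI[of _ "{A}"]) auto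
qed

lemma op_zero_span: "op_zero \<in> op_span T"
  unfolding op_span_def
  by (intro CollectI exI[of _ "\<lambda>_. 0"] exI[of _ "{}"]) (auto simp: op_sum_def op_zero_def)

text \<open>The summand from the other span is taken to be \<open>op_zero\<close>.\<close>

lemma tensor_mem_cartesian_left:
  assumes "T \<in> edge_space G" "R \<in> commutant (basis H) (vertex_algebra H)"
  shows "op_tensor T R \<in> edge_space (G \<box> H)"
proof -
  have "op_tensor T R = op_add (op_tensor T R) op_zero"
    by (simp add: op_add_def op_zero_def)
  moreover have "op_tensor T R \<in> op_span {op_tensor T R |T R.
      T \<in> edge_space G \<and> R \<in> commutant (basis H) (vertex_algebra H)}"
    using assms by (intro op_span_base) blast
  ultimately show ?thesis
    using op_zero_span unfolding cartesian_product_def qgraph.simps by blast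
qed

lemma tensor_mem_cartesian_right:
  assumes "R \<in> commutant (basis G) (vertex_algebra G)" "T \<in> edge_space H"
  shows "op_tensor R T \<in> edge_space (G \<box> H)"
proof -
  have "op_tensor R T = op_add op_zero (op_tensor R T)"
    by (simp add: op_add_def op_zero_def)
  moreover have "op_tensor R T \<in> op_span {op_tensor R T |R T.
      R \<in> commutant (basis G) (vertex_algebra G) \<and> T \<in> edge_space H}"
    using assms by (intro op_span_base) blast
  ultimately show ?thesis
    using op_zero_span unfolding cartesian_product_def qgraph.simps by blast
qed

text \<open>The easy inclusion of the commutation theorem for tensor products. The commutant of
  \<open>vn_tensor\<close> is the double commutant of \<open>?C\<close>, so it suffices to commute
  with elementary tensors, which is checked factorwise.\<close>

lemma tensor_mem_commutant_vn_tensor: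
  assumes fin: "finite X" "finite Y"
    and R: "R \<in> commutant X M" and Q: "Q \<in> commutant Y N"
  shows "op_tensor R Q \<in> commutant (X \<times> Y) (vn_tensor X M Y N)"
proof -
  let ?C = "commutant (X \<times> Y) {op_tensor A B |A B. A \<in> M \<and> B \<in> N}"
  have "op_tensor R Q \<in> ?C"
    using assms by (auto simp: commutant_def op_tensor_bounded op_tensor_mult)
  moreover have "?C \<subseteq> bounded_ops (X \<times> Y)"
    by (auto simp: commutant_def)
  ultimately show ?thesis
    using subset_bicommutant[of ?C "X \<times> Y"] by (auto simp: vn_tensor_def)
qed

text \<open>The witness is T \<otimes> 1: the identity belongs to the commutant of the algebra of
  \<open>H\<close>, so an edge operator \<open>T\<close> of \<open>G\<close> yields one of the
  product.\<close>

lemma q_colourable_cartesian_left: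
  assumes G: "quantum_graph G" and H: "quantum_graph H" and c: "q_colourable (G \<box> H) c"
  shows "q_colourable G c"
proof (rule q_colourable_ampliation[where h = id and Y = "basis H", OF _ _ _ _ _ _ _ _ c])
  note finG = quantum_graphD(1)[OF G] and finH = quantum_graphD(1)[OF H]
  have I: "op_id (basis H) \<in> commutant (basis H) (vertex_algebra H)"
    using finH quantum_graphD(5)[OF H] by (rule op_id_commutant)
  have amp: "ampliation id (basis G) (basis H) T (op_tensor T (op_id (basis H)))"
    if "T \<in> bounded_ops (basis G)" for T
    using that finG
    by (auto simp: ampliation_def op_pull_def op_tensor_def op_id_def fun_eq_iff
        bounded_ops_finite)
  show "\<exists>T'\<in>edge_space (G \<box> H). ampliation id (basis G) (basis H) T T'"
    if "T \<in> edge_space G" for T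
    using tensor_mem_cartesian_left[OF that I] amp that quantum_graphD(4)[OF G] by blast
  show "\<exists>T'\<in>commutant (basis (G \<box> H)) (vertex_algebra (G \<box> H)).
      ampliation id (basis G) (basis H) T T'"
    if T: "T \<in> commutant (basis G) (vertex_algebra G)" for T
  proof
    show "op_tensor T (op_id (basis H)) \<in> commutant (basis (G \<box> H)) (vertex_algebra (G \<box> H))"
      using tensor_mem_commutant_vn_tensor[OF finG finH T I]
      by (simp add: cartesian_product_def)
  qed (use amp T in \<open>simp add: commutant_def\<close>)
qed (use quantum_graphD[OF G] quantum_graphD[OF H] in \<open>auto simp: cartesian_product_def\<close>)

text \<open>The transfer lemma expects the coloured graph in the first coordinate; pulling 1
  \<otimes> T back along \<open>prod.swap\<close> gives T \<otimes> 1.\<close>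

lemma q_colourable_cartesian_right:
  assumes G: "quantum_graph G" and H: "quantum_graph H" and c: "q_colourable (G \<box> H) c"
  shows "q_colourable H c"
proof (rule q_colourable_ampliation[where h = prod.swap and Y = "basis G", OF _ _ _ _ _ _ _ _ c])
  note finG = quantum_graphD(1)[OF G] and finH = quantum_graphD(1)[OF H]
  have I: "op_id (basis G) \<in> commutant (basis G) (vertex_algebra G)"
    using finG quantum_graphD(5)[OF G] by (rule op_id_commutant)
  have amp: "ampliation prod.swap (basis H) (basis G) T (op_tensor (op_id (basis G)) T)"
    if "T \<in> bounded_ops (basis H)" for T
    using that finH
    by (auto simp: ampliation_def op_pull_def op_tensor_def op_id_def fun_eq_iff
        bounded_ops_finite)
  show "\<exists>T'\<in>edge_space (G \<box> H). ampliation prod.swap (basis H) (basis G) T T'"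
    if "T \<in> edge_space H" for T
    using tensor_mem_cartesian_right[OF I that] amp that quantum_graphD(4)[OF H] by blast
  show "\<exists>T'\<in>commutant (basis (G \<box> H)) (vertex_algebra (G \<box> H)).
      ampliation prod.swap (basis H) (basis G) T T'"
    if T: "T \<in> commutant (basis H) (vertex_algebra H)" for T
  proof
    show "op_tensor (op_id (basis G)) T \<in> commutant (basis (G \<box> H)) (vertex_algebra (G \<box> H))"
      using tensor_mem_commutant_vn_tensor[OF finG finH I T]
      by (simp add: cartesian_product_def)
  qed (use amp T in \<open>simp add: commutant_def\<close>)
  show "bij_betw prod.swap (basis H \<times> basis G) (basis (G \<box> H))"
    by (simp add: cartesian_product_def bij_betw_def product_swap)
qed (use quantum_graphD[OF G] quantum_graphD[OF H] in auto)

theorem theorem2: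
  fixes G :: "'a qgraph" and H :: "'b qgraph"
  assumes "quantum_graph G" and "quantum_graph H"
  shows "max (chi_q G) (chi_q H) \<le> chi_q (G \<box> H)"
proof -
  \<comment> \<open>Every number of colours admissible for the product is admissible for the factor,
    so the factor's infimum runs over a larger set; an empty set for the product gives the bound
    \<infinity>.\<close>
  have "chi_q G \<le> chi_q (G \<box> H)"
    unfolding chi_q_def
    using q_colourable_cartesian_left[OF assms] by (intro Inf_superset_mono) auto
  moreover have "chi_q H \<le> chi_q (G \<box> H)"
    unfolding chi_q_def
    using q_colourable_cartesian_right[OF assms] by (intro Inf_superset_mono) auto
  ultimately show ?thesis by simp
qed

end
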